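(* Let $Q$ be a nonzero commutative unital ring, let $n$ be a positive integer and let $\mathbf w=(w_1,\ldots,w_n)\in\mathbb Z_{\ge1}^n$. Let $P_{\mathbf w}=Q[x_1,\ldots,x_n]$ be graded by $\deg x_i=w_i$ and let $d_{\mathbf w}=\operatorname{lcm}(w_1,\ldots,w_n)$. Let $N$ be the least length among vectors weakly equivalent to $\mathbf w$. Then for every integer $k\ge\max(1,N-2)$, the graded ring $P_{\mathbf w}^{(kd_{\mathbf w})}$ is generated in degree $1$.
   Context: For a $\mathbb Z_{\ge0}$-graded ring $S$ and an integer $r\ge1$, the $r$th Veronese subring is $S^{(r)}:=\bigoplus_{m\ge0}S_{rm}$, where $S_{rm}$ is the $m$th graded component of $S^{(r)}$. A graded ring $S$ is generated in degree $1$ if $S=S_0\oplus\bigoplus_{m\ge1}S_1^m$, where $S_1^m$ is the additive subgroup generated by $m$-fold products of elements of $S_1$. Consider the following operations on a nonempty vector $\mathbf w$ of positive integers: (1) permuting the entries; (2) adding or removing repeated entries; (3) multiplying all entries by the same positive integer or dividing all entries by a positive common divisor; (4) adding or removing entries equal to the least common multiple of the entries while not changing the least common multiple; (5) if the length of $\mathbf w$ is at least two and $\gcd(\mathbf w)=1$, choosing an index $i$ and either multiplying each entry $w_j$ with $j\ne i$ by the same positive integer coprime to $w_i$, or dividing each entry $w_j$ with $j\neq i$ by a positive common divisor of the entries $w_j$ with $j\ne i$. Two nonempty vectors of positive integers are weakly equivalent if they become equal after applying a suitable choice of any number of the operations (1)–(5). *)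

theory Defs
  imports Complex_Main "HOL-Library.Multiset" "HOL-Library.Poly_Mapping"
begin

section \<open>Graded rings\<close>

definition add_subgroup :: "'r::ring_1 set \<Rightarrow> bool" where
  "add_subgroup H \<longleftrightarrow> 0 \<in> H \<and> (\<forall>x\<in>H. \<forall>y\<in>H. x - y \<in> H)"

text \<open>\<open>T\<close> is the internal direct sum of the family \<open>A\<close> of additive subgroups of the ambient ring.\<close>

definition is_direct_sum :: "'r::ring_1 set \<Rightarrow> (nat \<Rightarrow> 'r set) \<Rightarrow> bool" where
  "is_direct_sum T A \<longleftrightarrow>
     (\<forall>m. add_subgroup (A m)) \<and>
     T = add_subgroup hull (\<Union>m. A m) \<and>
     (\<forall>I f. finite I \<longrightarrow> (\<forall>m\<in>I. f m \<in> A m) \<longrightarrow> (\<Sum>m\<in>I. f m) = 0 \<longrightarrow> (\<forall>m\<in>I. f m = 0))"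

text \<open>
  A graded ring is given by the family \<open>S\<close> of its graded components inside an ambient ring;
  its underlying ring is the subring \<open>ring_of S\<close>, the sum of the components.
\<close>

definition ring_of :: "(nat \<Rightarrow> 'r::ring_1 set) \<Rightarrow> 'r set" where
  "ring_of S = add_subgroup hull (\<Union>m. S m)"

definition graded_ring :: "(nat \<Rightarrow> 'r::ring_1 set) \<Rightarrow> bool" where
  "graded_ring S \<longleftrightarrow> is_direct_sum (ring_of S) S \<and> 1 \<in> S 0 \<and>
     (\<forall>i j. \<forall>x\<in>S i. \<forall>y\<in>S j. x * y \<in> S (i + j))"

definition veronese :: "nat \<Rightarrow> (nat \<Rightarrow> 'r::ring_1 set) \<Rightarrow> (nat \<Rightarrow> 'r set)" where
  "veronese r S = (\<lambda>m. S (r * m))"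

definition set_power :: "'r::ring_1 set \<Rightarrow> nat \<Rightarrow> 'r set" where
  "set_power X m = add_subgroup hull {prod_list xs | xs. length xs = m \<and> set xs \<subseteq> X}"

definition generated_in_degree_1 :: "(nat \<Rightarrow> 'r::ring_1 set) \<Rightarrow> bool" where
  "generated_in_degree_1 S \<longleftrightarrow>
     is_direct_sum (ring_of S) (\<lambda>m. if m = 0 then S 0 else set_power (S 1) m)"


section \<open>Weighted polynomial rings\<close>

text \<open>
  Polynomials in countably many variables are finitely supported maps from exponent vectors
  to coefficients, with the convolution product of \<^theory>\<open>HOL-Library.Poly_Mapping\<close>. The variables
  of \<open>poly_ring n\<close> are numbered \<open>0, \<dots>, n - 1\<close>.
\<close>

type_synonym 'q mpoly = "(nat \<Rightarrow>\<^sub>0 nat) \<Rightarrow>\<^sub>0 'q"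

definition poly_ring :: "nat \<Rightarrow> 'q::comm_ring_1 mpoly set" where
  "poly_ring n = {p. \<forall>a \<in> Poly_Mapping.keys p. Poly_Mapping.keys a \<subseteq> {..<n}}"

definition weighted_degree :: "nat list \<Rightarrow> (nat \<Rightarrow>\<^sub>0 nat) \<Rightarrow> nat" where
  "weighted_degree w a = (\<Sum>i<length w. Poly_Mapping.lookup a i * w ! i)"

definition weighted_poly :: "nat list \<Rightarrow> nat \<Rightarrow> 'q::comm_ring_1 mpoly set" where
  "weighted_poly w m =
     {p \<in> poly_ring (length w). \<forall>a \<in> Poly_Mapping.keys p. weighted_degree w a = m}"

lemma weighted_degree_add: "weighted_degree w (a + b) = weighted_degree w a + weighted_degree w b"
  by (simp add: weighted_degree_def lookup_add distrib_right sum.distrib)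

lemma add_subgroup_weighted_poly: "add_subgroup (weighted_poly w m)"
  using keys_diff unfolding add_subgroup_def weighted_poly_def poly_ring_def by fastforce

lemma add_subgroup_poly_ring: "add_subgroup (poly_ring n)"
  using keys_diff unfolding add_subgroup_def poly_ring_def by fastforce

lemma add_subgroup_hull: "add_subgroup (add_subgroup hull X)"
  by (rule hull_in) (auto simp: add_subgroup_def)

lemma add_subgroup_sum:
  assumes "add_subgroup H" "\<And>x. x \<in> I \<Longrightarrow> f x \<in> H"
  shows "sum f I \<in> H"
proof -
  have "x + y \<in> H" if "x \<in> H" "y \<in> H" for x y
  proof -
    have "x - (0 - y) \<in> H" using assms(1) that unfolding add_subgroup_def by blast
    then show ?thesis by simp
  qed
  then show ?thesis
    using assms by (induction I rule: infinite_finite_induct) (auto simp: add_subgroup_def)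
qed

lemma mpoly_sum_monomials:
  fixes p :: "'q::comm_ring_1 mpoly"
  shows "p = (\<Sum>a\<in>Poly_Mapping.keys p. Poly_Mapping.single a (Poly_Mapping.lookup p a))"
  by (rule poly_mapping_eqI)
     (simp add: lookup_sum lookup_single when_def in_keys_iff sum.delta)

lemma ring_of_weighted_poly:
  "ring_of (weighted_poly w) = (poly_ring (length w) :: 'q::comm_ring_1 mpoly set)"
proof
  show "ring_of (weighted_poly w) \<subseteq> (poly_ring (length w) :: 'q mpoly set)"
    unfolding ring_of_def
    by (rule hull_minimal) (auto simp: weighted_poly_def add_subgroup_poly_ring)
  show "(poly_ring (length w) :: 'q mpoly set) \<subseteq> ring_of (weighted_poly w)"
  proof
    fix p :: "'q mpoly" assume p: "p \<in> poly_ring (length w)"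
    have "Poly_Mapping.single a (Poly_Mapping.lookup p a) \<in> ring_of (weighted_poly w)"
      if "a \<in> Poly_Mapping.keys p" for a
    proof -
      have "Poly_Mapping.single a (Poly_Mapping.lookup p a) \<in> weighted_poly w (weighted_degree w a)"
        using p that by (auto simp: weighted_poly_def poly_ring_def)
      then show ?thesis unfolding ring_of_def by (intro hull_inc) blast
    qed
    then have "(\<Sum>a\<in>Poly_Mapping.keys p. Poly_Mapping.single a (Poly_Mapping.lookup p a))
        \<in> ring_of (weighted_poly w)"
      by (intro add_subgroup_sum) (auto simp: ring_of_def add_subgroup_hull)
    then show "p \<in> ring_of (weighted_poly w)"
      by (simp only: mpoly_sum_monomials[symmetric])
  qed
qed

lemma graded_ring_weighted_poly: "graded_ring (weighted_poly w :: nat \<Rightarrow> 'q::comm_ring_1 mpoly set)"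
proof -
  have indep: "f m = 0"
    if I: "finite I" "\<forall>m\<in>I. f m \<in> weighted_poly w m" "(\<Sum>m\<in>I. f m) = 0" "m \<in> I"
    for I m and f :: "nat \<Rightarrow> 'q mpoly"
  proof (rule poly_mapping_eqI)
    fix a
    have z: "Poly_Mapping.lookup (f k) a = 0" if "k \<in> I" "k \<noteq> weighted_degree w a" for k
      using I(2) that by (metis (mono_tags, lifting) in_keys_iff mem_Collect_eq weighted_poly_def)
    have "(\<Sum>k\<in>I. Poly_Mapping.lookup (f k) a) = 0"
      by (metis I(3) lookup_sum lookup_zero)
    moreover have "(\<Sum>k\<in>I. Poly_Mapping.lookup (f k) a) = Poly_Mapping.lookup (f m) a"
      if "m = weighted_degree w a"
      using I(1,4) z that by (subst sum.remove[of _ m]) (auto intro!: sum.neutral)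
    ultimately show "Poly_Mapping.lookup (f m) a = Poly_Mapping.lookup 0 a"
      using z I(4) by (cases "m = weighted_degree w a") auto
  qed
  have mult: "x * y \<in> weighted_poly w (i + j)"
    if x: "x \<in> weighted_poly w i" and y: "y \<in> weighted_poly w j" for i j and x y :: "'q mpoly"
  proof -
    have "Poly_Mapping.keys c \<subseteq> {..<length w} \<and> weighted_degree w c = i + j"
      if c: "c \<in> Poly_Mapping.keys (x * y)" for c
    proof -
      obtain a b where ab: "c = a + b" "a \<in> Poly_Mapping.keys x" "b \<in> Poly_Mapping.keys y"
        using keys_mult[of x y] c by blast
      have "Poly_Mapping.keys a \<subseteq> {..<length w}" "Poly_Mapping.keys b \<subseteq> {..<length w}"
        using x y ab by (auto simp: weighted_poly_def poly_ring_def)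
      moreover have "weighted_degree w c = i + j"
        using x y ab by (auto simp: weighted_poly_def weighted_degree_add)
      ultimately show ?thesis using Poly_Mapping.keys_add[of a b] ab(1) by blast
    qed
    then show ?thesis by (auto simp: weighted_poly_def poly_ring_def)
  qed
  have "(1 :: 'q mpoly) \<in> weighted_poly w 0"
    by (simp add: weighted_poly_def poly_ring_def weighted_degree_def)
  then show ?thesis
    using indep mult
    by (auto simp: graded_ring_def is_direct_sum_def add_subgroup_weighted_poly ring_of_def)
qed


section \<open>Weak equivalence of weight vectors\<close>

definition weight_vector :: "nat list \<Rightarrow> bool" where
  "weight_vector w \<longleftrightarrow> w \<noteq> [] \<and> (\<forall>x\<in>set w. x \<ge> 1)"

text \<open>
  Single applications of the operations. Adding or removing several entries is done one entry
  at a time. The requirement \<open>xs @ ys \<noteq> []\<close> in \<open>remove_lcm\<close> keeps the vector nonempty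
  (otherwise \<open>[1]\<close> could be reduced to \<open>[]\<close>).
\<close>

inductive operation :: "nat list \<Rightarrow> nat list \<Rightarrow> bool" where
  permute: "mset v = mset w \<Longrightarrow> operation w v"
| add_repeated: "x \<in> set (xs @ ys) \<Longrightarrow> operation (xs @ ys) (xs @ x # ys)"
| remove_repeated: "x \<in> set (xs @ ys) \<Longrightarrow> operation (xs @ x # ys) (xs @ ys)"
| multiply: "c \<ge> 1 \<Longrightarrow> operation w (map (\<lambda>x. c * x) w)"
| divide: "c \<ge> 1 \<Longrightarrow> \<forall>x\<in>set w. c dvd x \<Longrightarrow> operation w (map (\<lambda>x. x div c) w)"
| add_lcm:
    "xs @ ys \<noteq> [] \<Longrightarrow> x = Lcm (set (xs @ ys)) \<Longrightarrow> Lcm (set (xs @ x # ys)) = Lcm (set (xs @ ys)) \<Longrightarrow>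
     operation (xs @ ys) (xs @ x # ys)"
| remove_lcm:
    "xs @ ys \<noteq> [] \<Longrightarrow> x = Lcm (set (xs @ x # ys)) \<Longrightarrow> Lcm (set (xs @ ys)) = Lcm (set (xs @ x # ys)) \<Longrightarrow>
     operation (xs @ x # ys) (xs @ ys)"
| multiply_others:
    "length w \<ge> 2 \<Longrightarrow> Gcd (set w) = 1 \<Longrightarrow> i < length w \<Longrightarrow> c \<ge> 1 \<Longrightarrow> coprime c (w ! i) \<Longrightarrow>
     operation w (map (\<lambda>j. if j = i then w ! j else c * w ! j) [0..<length w])"
| divide_others:
    "length w \<ge> 2 \<Longrightarrow> Gcd (set w) = 1 \<Longrightarrow> i < length w \<Longrightarrow> c \<ge> 1 \<Longrightarrow>
     \<forall>j<length w. j \<noteq> i \<longrightarrow> c dvd w ! j \<Longrightarrow>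
     operation w (map (\<lambda>j. if j = i then w ! j else w ! j div c) [0..<length w])"

definition weakly_equivalent :: "nat list \<Rightarrow> nat list \<Rightarrow> bool" where
  "weakly_equivalent v w \<longleftrightarrow> weight_vector v \<and> weight_vector w \<and>
     (\<exists>u. operation\<^sup>*\<^sup>* v u \<and> operation\<^sup>*\<^sup>* w u)"

definition least_weak_length :: "nat list \<Rightarrow> nat" where
  "least_weak_length w = (LEAST l. \<exists>v. weakly_equivalent v w \<and> length v = l)"

end

theory Submission
  imports Defs "HOL-Library.FuncSet"
begin

text \<open>
  Write \<open>d\<close> for the least common multiple of the weights. Say that the weights split beyond \<open>k\<close> if
  every monomial of degree \<open>q * d\<close> with \<open>q > k\<close> is divisible by a monomial of degree \<open>d\<close>. If this
  holds, then dividing repeatedly turns a monomial of degree \<open>m * k * d\<close> into a product of \<open>m\<close>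
  monomials of degree \<open>k * d\<close>, so the \<open>k * d\<close>-th Veronese subring is generated in degree 1.
  (Generation in degree 1 is by itself not visibly stable under adding an entry \<open>d\<close>; splitting is.)

  Splitting is invariant under the operations (1)-(5), so one may pass to a vector of least length
  \<open>N\<close> and has to show that \<open>N\<close> weights split beyond \<open>k\<close> whenever \<open>k \<ge> N - 2\<close>. Exponent vectors of
  degree \<open>d\<close> are the lattice points of a lattice simplex. A vector \<open>a\<close> of degree \<open>q * d\<close> is a
  nonnegative combination \<open>\<Sum> l i * v i\<close> of \<open>N\<close> linearly independent such points, with \<open>\<Sum> l i = q\<close>.
  If some \<open>l i \<ge> 1\<close>, then \<open>v i \<le> a\<close>. Otherwise \<open>q = N - 1\<close>, so \<open>u = \<Sum> (1 - l i) * v i\<close> is again a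
  lattice point of degree \<open>d\<close>, and exchanging it for a suitable \<open>v i\<close> lowers \<open>\<Sum> l i * |v i|\<^sup>2\<close> by
  strict convexity. Hence a representation minimizing this sum has some \<open>l i \<ge> 1\<close>.
\<close>

section \<open>Invariance of splitting under weak equivalence\<close>

text \<open>The index set is arbitrary so that the notion applies both to the positions of a list
  and to the set of its entries, where order and repetition disappear.\<close>

definition splits :: "nat \<Rightarrow> 'i set \<Rightarrow> ('i \<Rightarrow> nat) \<Rightarrow> bool" where
  "splits k I w \<longleftrightarrow> (\<forall>q a. k < q \<longrightarrow> (\<Sum>i\<in>I. a i * w i) = q * Lcm (w ` I) \<longrightarrow>
     (\<exists>b. (\<forall>i\<in>I. b i \<le> a i) \<and> (\<Sum>i\<in>I. b i * w i) = Lcm (w ` I)))"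

lemma splitsD:
  assumes "splits k I w" "k < q" "(\<Sum>i\<in>I. a i * w i) = q * Lcm (w ` I)"
  obtains b where "\<And>i. i \<in> I \<Longrightarrow> b i \<le> a i" "(\<Sum>i\<in>I. b i * w i) = Lcm (w ` I)"
  using assms unfolding splits_def by blast

text \<open>Greedy choice: each index in turn takes as much of \<open>s\<close> as its bound allows.
  This will distribute an exponent over variables of equal weight.\<close>

lemma sum_le_split:
  fixes a :: "'i \<Rightarrow> nat"
  assumes "finite I" "s \<le> sum a I"
  obtains b where "\<And>i. i \<in> I \<Longrightarrow> b i \<le> a i" "sum b I = s"
  using assms
proof (induction I arbitrary: s thesis rule: finite_induct)
  case empty
  then show ?case by simp
next
  case (insert i I)
  have "s - min s (a i) \<le> sum a I" using insert by simp
  from insert.IH[OF _ this] obtain b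
    where b: "\<And>i. i \<in> I \<Longrightarrow> b i \<le> a i" "sum b I = s - min s (a i)" by blast
  have "sum (b(i := min s (a i))) (insert i I) = min s (a i) + sum b I"
    using insert.hyps by (simp add: fun_upd_def) (intro sum.cong, auto)
  then show ?case using b by (intro insert.prems(1)[of "b(i := min s (a i))"]) auto
qed

text \<open>The weight \<open>w \<circ> f\<close> is constant on the fibres of \<open>f\<close>, so
  the degree depends only on the sums of the exponents over the fibres. Exponents may be collected
  on one representative of a fibre or spread over the fibre.\<close>

lemma splits_comp:
  assumes fin: "finite I"
  shows "splits k I (w \<circ> f) \<longleftrightarrow> splits k (f ` I) w"
proof
  have push: "(\<Sum>i\<in>I. a i * w (f i)) = (\<Sum>x\<in>f ` I. (\<Sum>i\<in>{i\<in>I. f i = x}. a i) * w x)" for a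
    using fin by (subst sum.image_gen[of _ _ f]) (auto simp: sum_distrib_right intro!: sum.cong)
  show "splits k (f ` I) w" if S: "splits k I (w \<circ> f)"
    unfolding splits_def
  proof (intro allI impI)
    fix q a assume q: "k < q" and a: "(\<Sum>x\<in>f ` I. a x * w x) = q * Lcm (w ` f ` I)"
    define g where "g = inv_into I f"
    \<comment> \<open>The whole exponent of a fibre sits on its representative \<open>g x\<close>,
      so the fibre sums are given by \<open>a\<close>.\<close>
    define a' where "a' = (\<lambda>i. if g (f i) = i then a (f i) else 0)"
    have fib: "(\<Sum>i\<in>{i\<in>I. f i = x}. a' i) = a x" if x: "x \<in> f ` I" for x
    proof -
      have gx: "g x \<in> I" "f (g x) = x" using x by (auto simp: g_def inv_into_into f_inv_into_f)
      have "(\<Sum>i\<in>{i\<in>I. f i = x}. a' i) = (\<Sum>i\<in>{i\<in>I. f i = x}. if i = g x then a x else 0)"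
        by (intro sum.cong) (auto simp: a'_def)
      then show ?thesis using fin gx by simp
    qed
    have "(\<Sum>i\<in>I. a' i * (w \<circ> f) i) = q * Lcm ((w \<circ> f) ` I)"
      using a by (simp add: push fib image_comp cong: sum.cong)
    then obtain b where b: "\<And>i. i \<in> I \<Longrightarrow> b i \<le> a' i"
      "(\<Sum>i\<in>I. b i * (w \<circ> f) i) = Lcm ((w \<circ> f) ` I)"
      using splitsD[OF S q] by blast
    have "(\<Sum>i\<in>{i\<in>I. f i = x}. b i) \<le> a x" if "x \<in> f ` I" for x
      unfolding fib[OF that, symmetric] using b by (intro sum_mono) auto
    then show "\<exists>b. (\<forall>x\<in>f ` I. b x \<le> a x) \<and> (\<Sum>x\<in>f ` I. b x * w x) = Lcm (w ` f ` I)"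
      using b(2) by (intro exI[of _ "\<lambda>x. \<Sum>i\<in>{i\<in>I. f i = x}. b i"]) (auto simp: push image_comp)
  qed
  show "splits k I (w \<circ> f)" if S: "splits k (f ` I) w"
    unfolding splits_def
  proof (intro allI impI)
    fix q a assume q: "k < q" and "(\<Sum>i\<in>I. a i * (w \<circ> f) i) = q * Lcm ((w \<circ> f) ` I)"
    then have "(\<Sum>x\<in>f ` I. (\<Sum>i\<in>{i\<in>I. f i = x}. a i) * w x) = q * Lcm (w ` f ` I)"
      by (simp add: push image_comp)
    then obtain b where b: "\<And>x. x \<in> f ` I \<Longrightarrow> b x \<le> (\<Sum>i\<in>{i\<in>I. f i = x}. a i)"
      "(\<Sum>x\<in>f ` I. b x * w x) = Lcm (w ` f ` I)"
      by (rule splitsD[OF S q, where a = "\<lambda>x. \<Sum>i\<in>{i\<in>I. f i = x}. a i"]) blast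
    \<comment> \<open>Each \<open>b x\<close> is spread over its fibre below the bounds
      \<open>a i\<close>; the local choices \<open>c x\<close> are then glued to
      \<open>c (f i) i\<close>.\<close>
    have "\<forall>x\<in>f ` I. \<exists>c. (\<forall>i\<in>{i\<in>I. f i = x}. c i \<le> a i) \<and>
        (\<Sum>i\<in>{i\<in>I. f i = x}. c i) = b x"
    proof
      fix x assume "x \<in> f ` I"
      then obtain c where "\<And>i. i \<in> {i\<in>I. f i = x} \<Longrightarrow> c i \<le> a i"
        "(\<Sum>i\<in>{i\<in>I. f i = x}. c i) = b x"
        using b(1) fin sum_le_split[of "{i\<in>I. f i = x}" "b x" a] by auto
      then show "\<exists>c. (\<forall>i\<in>{i\<in>I. f i = x}. c i \<le> a i) \<and> (\<Sum>i\<in>{i\<in>I. f i = x}. c i) = b x"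
        by blast
    qed
    from bchoice[OF this] obtain c where c: "\<And>x i. i \<in> I \<Longrightarrow> f i = x \<Longrightarrow> c x i \<le> a i"
      "\<And>x. x \<in> f ` I \<Longrightarrow> (\<Sum>i\<in>{i\<in>I. f i = x}. c x i) = b x"
      by auto
    have "(\<Sum>i\<in>{i\<in>I. f i = x}. c (f i) i) = b x" if "x \<in> f ` I" for x
      unfolding c(2)[OF that, symmetric] by (intro sum.cong) auto
    then have "(\<Sum>i\<in>I. c (f i) i * (w \<circ> f) i) = Lcm ((w \<circ> f) ` I)"
      using b(2) by (simp add: push image_comp cong: sum.cong)
    then show "\<exists>b. (\<forall>i\<in>I. b i \<le> a i) \<and> (\<Sum>i\<in>I. b i * (w \<circ> f) i) = Lcm ((w \<circ> f) ` I)"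
      using c(1) by (intro exI[of _ "\<lambda>i. c (f i) i"]) auto
  qed
qed

text \<open>Passing to the set of entries makes permutations and repeated entries harmless.\<close>

lemma splits_nth: "splits k {..<length w} ((!) w) \<longleftrightarrow> splits k (set w) (\<lambda>x. x)"
proof -
  have "(!) w ` {..<length w} = set w" by (auto simp: in_set_conv_nth)
  then show ?thesis using splits_comp[of "{..<length w}" k "\<lambda>x. x" "(!) w"] by (simp add: comp_def)
qed

section \<open>Scaling all weights, and entries equal to the lcm\<close>

lemma Lcm_image_mult_nat:
  fixes c :: nat
  assumes "X \<noteq> {}"
  shows "Lcm ((*) c ` X) = c * Lcm X"
  using assms Lcm_mult[of X c] by simp

lemma splits_mult:
  assumes fin: "finite X" and c: "1 \<le> c"
  shows "splits k ((*) c ` X) (\<lambda>x. x) \<longleftrightarrow> splits k X (\<lambda>x. x)"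
proof (cases "X = {}")
  case False
  have "splits k ((*) c ` X) (\<lambda>x. x) \<longleftrightarrow> splits k X ((*) c)"
    using splits_comp[OF fin, of k "\<lambda>x. x" "(*) c"] by (simp add: comp_def)
  also have "\<dots> \<longleftrightarrow> splits k X (\<lambda>x. x)"
  proof -
    have "(\<Sum>x\<in>X. a x * (c * x)) = c * (\<Sum>x\<in>X. a x * x)" for a
      by (simp add: sum_distrib_left algebra_simps)
    then show ?thesis
      using c by (simp add: splits_def Lcm_image_mult_nat[OF False] mult.left_commute[of _ c])
  qed
  finally show ?thesis .
qed simp

text \<open>If the new variable occurs, it is itself a divisor of degree \<open>Lcm X\<close>; if it
  does not, the monomials are the old ones. Exponent functions are arbitrary off \<open>X\<close>,
  so their value at \<open>Lcm X\<close> is reset to 0 where necessary.\<close>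

lemma splits_insert_Lcm:
  assumes fin: "finite X"
  shows "splits k (insert (Lcm X) X) (\<lambda>x. x) \<longleftrightarrow> splits k X (\<lambda>x. x)"
proof (cases "Lcm X \<in> X")
  case True
  then show ?thesis by (simp add: insert_absorb)
next
  case False
  have L: "Lcm (insert (Lcm X) X) = Lcm X" by simp
  show ?thesis
  proof
    show "splits k X (\<lambda>x. x)" if S: "splits k (insert (Lcm X) X) (\<lambda>x. x)"
      unfolding splits_def
    proof (intro allI impI)
      fix q a assume q: "k < q" and a: "(\<Sum>x\<in>X. a x * x) = q * Lcm ((\<lambda>x. x) ` X)"
      let ?a = "a(Lcm X := 0)"
      have ext: "(\<Sum>x\<in>insert (Lcm X) X. b x * x) = b (Lcm X) * Lcm X + (\<Sum>x\<in>X. b x * x)" for b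
        using fin False by simp
      have "(\<Sum>x\<in>X. ?a x * x) = (\<Sum>x\<in>X. a x * x)" using False by (intro sum.cong) auto
      then have "(\<Sum>x\<in>insert (Lcm X) X. ?a x * x) = q * Lcm ((\<lambda>x. x) ` insert (Lcm X) X)"
        using a by (simp only: ext image_ident L) simp
      then obtain b where b: "\<And>x. x \<in> insert (Lcm X) X \<Longrightarrow> b x \<le> ?a x"
        "(\<Sum>x\<in>insert (Lcm X) X. b x * x) = Lcm ((\<lambda>x. x) ` insert (Lcm X) X)"
        using splitsD[OF S q] by blast
      have "b x \<le> a x" if "x \<in> X" for x using b(1)[of x] that False by (auto split: if_splits)
      moreover have "b (Lcm X) = 0" using b(1)[of "Lcm X"] by simp
      ultimately show "\<exists>b. (\<forall>x\<in>X. b x \<le> a x) \<and> (\<Sum>x\<in>X. b x * x) = Lcm ((\<lambda>x. x) ` X)"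
        using b(2) by (intro exI[of _ b]) (simp only: ext image_ident L, simp)
    qed
    show "splits k (insert (Lcm X) X) (\<lambda>x. x)" if S: "splits k X (\<lambda>x. x)"
      unfolding splits_def image_ident L
    proof (intro allI impI)
      fix q a assume q: "k < q" and a: "(\<Sum>x\<in>insert (Lcm X) X. a x * x) = q * Lcm X"
      show "\<exists>b. (\<forall>x\<in>insert (Lcm X) X. b x \<le> a x) \<and> (\<Sum>x\<in>insert (Lcm X) X. b x * x) = Lcm X"
      proof (cases "a (Lcm X) = 0")
        case True
        then have "(\<Sum>x\<in>X. a x * x) = q * Lcm ((\<lambda>x. x) ` X)" using a fin False by simp
        then obtain b where b: "\<And>x. x \<in> X \<Longrightarrow> b x \<le> a x" "(\<Sum>x\<in>X. b x * x) = Lcm X"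
          using splitsD[OF S q] by auto
        have "(\<Sum>x\<in>X. (b(Lcm X := 0)) x * x) = (\<Sum>x\<in>X. b x * x)"
          using False by (intro sum.cong) auto
        then show ?thesis using b fin False by (intro exI[of _ "b(Lcm X := 0)"]) auto
      next
        case nz: False
        have "(\<Sum>x\<in>X. (if x = Lcm X then 1 else 0) * x) = 0" using False by (intro sum.neutral) auto
        then show ?thesis
          using fin False nz by (intro exI[of _ "\<lambda>x. if x = Lcm X then 1 else 0"]) auto
      qed
    qed
  qed
qed

section \<open>Scaling all weights but one\<close>

lemma Lcm_insert_mult_coprime:
  fixes c y :: nat
  assumes "coprime c y" "Y \<noteq> {}"
  shows "Lcm (insert y ((*) c ` Y)) = c * Lcm (insert y Y)"
proof -
  have "lcm y (c * Lcm Y) = c * lcm y (Lcm Y)"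
  proof (rule dvd_antisym)
    show "lcm y (c * Lcm Y) dvd c * lcm y (Lcm Y)" by (auto intro: mult_dvd_mono)
    \<comment> \<open>Both \<open>c\<close> and \<open>y\<close> divide the right-hand side, and
      they are coprime.\<close>
    have "c * y dvd lcm y (c * Lcm Y)"
      using assms(1) by (intro divides_mult) (auto intro: dvd_trans[OF dvd_triv_left])
    then show "c * lcm y (Lcm Y) dvd lcm y (c * Lcm Y)"
      using lcm_mult_left[of c y "Lcm Y"] by (metis dvd_lcm2 lcm_least normalize_nat_def id_apply)
  qed
  then show ?thesis by (simp add: Lcm_image_mult_nat[OF assms(2)])
qed

text \<open>Multiplying the exponent of \<open>i\<close> by \<open>c\<close> multiplies the degree
  by \<open>c\<close>, just as the lcm is multiplied by \<open>c\<close>. This correspondence of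
  monomials respects divisibility in both directions.\<close>

lemma splits_mult_others:
  fixes w :: "'i \<Rightarrow> nat"
  assumes fin: "finite I" and i: "i \<in> I" "I - {i} \<noteq> {}" and c: "1 \<le> c" "coprime c (w i)"
  shows "splits k I (\<lambda>j. if j = i then w j else c * w j) \<longleftrightarrow> splits k I w"
proof -
  let ?w = "\<lambda>j. if j = i then w j else c * w j"
  have "w ` I = insert (w i) (w ` (I - {i}))" "?w ` I = insert (w i) ((*) c ` w ` (I - {i}))"
    using i by (auto simp: image_iff)
  then have L: "Lcm (?w ` I) = c * Lcm (w ` I)"
    using Lcm_insert_mult_coprime[OF c(2)] i(2) by simp
  have deg: "(\<Sum>j\<in>I. b j * w j) = b i * w i + (\<Sum>j\<in>I-{i}. b j * w j)" for b
    using fin i by (simp add: sum.remove[of I i])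
  have deg': "(\<Sum>j\<in>I. b j * ?w j) = b i * w i + c * (\<Sum>j\<in>I-{i}. b j * w j)" for b
    using fin i by (simp add: sum.remove[of I i] sum_distrib_left mult.left_commute)
  have scale: "(\<Sum>j\<in>I. (b(i := c * b i)) j * ?w j) = c * (\<Sum>j\<in>I. b j * w j)" for b
  proof -
    have "(\<Sum>j\<in>I-{i}. (b(i := c * b i)) j * w j) = (\<Sum>j\<in>I-{i}. b j * w j)"
      by (intro sum.cong) auto
    then show ?thesis by (simp only: deg deg') (simp add: distrib_left)
  qed
  \<comment> \<open>Modulo \<open>c\<close> only the term \<open>a i * w i\<close> of the degree
    survives, so coprimality makes \<open>c\<close> divide \<open>a i\<close>.\<close>
  have unscale: "\<exists>a'. a i = c * a' \<and> (\<Sum>j\<in>I. (a(i := a')) j * w j) = m"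
    if "(\<Sum>j\<in>I. a j * ?w j) = c * m" for a m
  proof -
    have "c dvd a i * w i"
      using that unfolding deg' by (metis dvd_add_times_triv_right_iff dvd_triv_left mult.commute)
    then obtain a' where a': "a i = c * a'" using c(2) by (auto simp: coprime_dvd_mult_left_iff)
    then have "a = (a(i := a'))(i := c * (a(i := a')) i)" by auto
    then have "c * (\<Sum>j\<in>I. (a(i := a')) j * w j) = c * m"
      using that scale[of "a(i := a')"] by metis
    then show ?thesis using a' c(1) by auto
  qed
  show ?thesis
  proof
    show "splits k I w" if S: "splits k I ?w"
      unfolding splits_def
    proof (intro allI impI)
      fix q a assume q: "k < q" and "(\<Sum>j\<in>I. a j * w j) = q * Lcm (w ` I)"
      then have "(\<Sum>j\<in>I. (a(i := c * a i)) j * ?w j) = q * Lcm (?w ` I)"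
        unfolding scale L by simp
      then obtain b where b: "\<And>j. j \<in> I \<Longrightarrow> b j \<le> (a(i := c * a i)) j"
        "(\<Sum>j\<in>I. b j * ?w j) = Lcm (?w ` I)"
        using splitsD[OF S q] by blast
      obtain b' where b': "b i = c * b'" "(\<Sum>j\<in>I. (b(i := b')) j * w j) = Lcm (w ` I)"
        using unscale[of b "Lcm (w ` I)"] b(2) L by auto
      have "(b(i := b')) j \<le> a j" if "j \<in> I" for j
        using b(1)[OF that] b'(1) c(1) by (auto split: if_splits)
      then show "\<exists>b. (\<forall>j\<in>I. b j \<le> a j) \<and> (\<Sum>j\<in>I. b j * w j) = Lcm (w ` I)"
        using b'(2) by blast
    qed
    show "splits k I ?w" if S: "splits k I w"
      unfolding splits_def
    proof (intro allI impI)
      fix q a assume q: "k < q" and "(\<Sum>j\<in>I. a j * ?w j) = q * Lcm (?w ` I)"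
      then have "(\<Sum>j\<in>I. a j * ?w j) = c * (q * Lcm (w ` I))"
        unfolding L by (simp only: mult.left_commute)
      from unscale[OF this] obtain a' where a': "a i = c * a'" "(\<Sum>j\<in>I. (a(i := a')) j * w j) = q * Lcm (w ` I)"
        by blast
      obtain b where b: "\<And>j. j \<in> I \<Longrightarrow> b j \<le> (a(i := a')) j" "(\<Sum>j\<in>I. b j * w j) = Lcm (w ` I)"
        using splitsD[OF S q a'(2)] by blast
      have "(b(i := c * b i)) j \<le> a j" if "j \<in> I" for j
        using b(1)[OF that] a'(1) by (auto split: if_splits)
      moreover have "(\<Sum>j\<in>I. (b(i := c * b i)) j * ?w j) = Lcm (?w ` I)"
        unfolding scale L b(2) ..
      ultimately show "\<exists>b. (\<forall>j\<in>I. b j \<le> a j) \<and> (\<Sum>j\<in>I. b j * ?w j) = Lcm (?w ` I)"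
        by blast
    qed
  qed
qed

lemma splits_cong:
  assumes "\<And>i. i \<in> I \<Longrightarrow> v i = w i"
  shows "splits k I v \<longleftrightarrow> splits k I w"
proof -
  have "v ` I = w ` I" "(\<Sum>i\<in>I. b i * v i) = (\<Sum>i\<in>I. b i * w i)" for b
    using assms by (auto intro: sum.cong)
  then show ?thesis by (simp add: splits_def)
qed

text \<open>Each operation either keeps the set of entries or falls under one of the invariance
  lemmas above, the divisions being read backwards as multiplications.\<close>

lemma splits_operation:
  assumes "operation w v"
  shows "splits k (set w) (\<lambda>x. x) \<longleftrightarrow> splits k (set v) (\<lambda>x. x)"
proof -
  have others: "splits k (set (map (\<lambda>j. if j = i then w ! j else c * w ! j) [0..<length w])) (\<lambda>x. x)
      \<longleftrightarrow> splits k (set w) (\<lambda>x. x)"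
    if w: "2 \<le> length w" "i < length w" "1 \<le> c" "coprime c (w ! i)" for w i c
  proof -
    have "card ({..<length w} - {i}) \<noteq> 0" using w by simp
    then have ne: "{..<length w} - {i} \<noteq> {}" by force
    let ?v = "map (\<lambda>j. if j = i then w ! j else c * w ! j) [0..<length w]"
    have "splits k (set ?v) (\<lambda>x. x) \<longleftrightarrow> splits k {..<length w} ((!) ?v)"
      using splits_nth[of k ?v] by simp
    also have "\<dots> \<longleftrightarrow> splits k {..<length w} (\<lambda>j. if j = i then w ! j else c * w ! j)"
      by (intro splits_cong) simp
    also have "\<dots> \<longleftrightarrow> splits k {..<length w} ((!) w)"
      using w ne by (intro splits_mult_others) auto
    finally show ?thesis by (simp add: splits_nth)
  qed
  show ?thesis using assms
  proof cases
    case permute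
    then show ?thesis by (metis set_mset_mset)
  next
    case (add_repeated x xs ys)
    then show ?thesis by (auto simp: insert_absorb)
  next
    case (remove_repeated x xs ys)
    then show ?thesis by (auto simp: insert_absorb)
  next
    case (multiply c)
    then show ?thesis by (simp add: splits_mult)
  next
    case (divide c)
    have "(*) c ` set v = set w"
      using divide by (force simp: image_image)
    then show ?thesis using splits_mult[of "set v" c k] divide(2) by simp
  next
    case (add_lcm xs ys x)
    have "set v = insert (Lcm (set w)) (set w)" using add_lcm by auto
    then show ?thesis by (simp only: splits_insert_Lcm finite_set)
  next
    case (remove_lcm xs ys x)
    have "set w = insert (Lcm (set v)) (set v)" using remove_lcm by auto
    then show ?thesis by (simp only: splits_insert_Lcm finite_set)
  next
    case (multiply_others i c)
    then show ?thesis using others by simp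
  next
    case (divide_others i c)
    have v: "length v = length w" "v ! i = w ! i"
      "\<And>j. j < length w \<Longrightarrow> j \<noteq> i \<Longrightarrow> c * v ! j = w ! j"
      using divide_others by auto
    \<comment> \<open>A common divisor of \<open>c\<close> and \<open>w ! i\<close> divides every
      entry, so gcd 1 yields the coprimality needed to read the division backwards.\<close>
    have "coprime c (w ! i)"
    proof (rule coprimeI)
      fix e assume e: "e dvd c" "e dvd w ! i"
      have "e dvd x" if "x \<in> set w" for x
        using that e divide_others(6) by (metis dvd_trans in_set_conv_nth)
      then have "e dvd Gcd (set w)" by (rule Gcd_greatest)
      then show "is_unit e" using divide_others by simp
    qed
    then have "splits k (set (map (\<lambda>j. if j = i then v ! j else c * v ! j) [0..<length v])) (\<lambda>x. x)
      \<longleftrightarrow> splits k (set v) (\<lambda>x. x)"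
      using divide_others v by (intro others) auto
    moreover have "map (\<lambda>j. if j = i then v ! j else c * v ! j) [0..<length v] = w"
      using v by (intro nth_equalityI) auto
    ultimately show ?thesis by simp
  qed
qed

lemma splits_weakly_equivalent:
  assumes "weakly_equivalent v w"
  shows "splits k (set v) (\<lambda>x. x) \<longleftrightarrow> splits k (set w) (\<lambda>x. x)"
proof -
  have "splits k (set v) (\<lambda>x. x) \<longleftrightarrow> splits k (set u) (\<lambda>x. x)" if "operation\<^sup>*\<^sup>* v u" for u v
    using that by induction (simp_all add: splits_operation)
  then show ?thesis using assms unfolding weakly_equivalent_def by metis
qed

section \<open>Splitting for few weights\<close>

text \<open>Vectors and coordinates share the index set \<open>I\<close>, so for finite
  \<open>I\<close> an independent family is a basis of the real vector space of functions on
  \<open>I\<close>.\<close>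

definition lin_indep :: "'i set \<Rightarrow> ('i \<Rightarrow> 'i \<Rightarrow> nat) \<Rightarrow> bool" where
  "lin_indep I v \<longleftrightarrow>
     (\<forall>c::'i \<Rightarrow> real. (\<forall>x\<in>I. (\<Sum>i\<in>I. c i * v i x) = 0) \<longrightarrow> (\<forall>i\<in>I. c i = 0))"

lemma lin_indepD:
  fixes c :: "'i \<Rightarrow> real"
  assumes "lin_indep I v" "\<And>x. x \<in> I \<Longrightarrow> (\<Sum>i\<in>I. c i * v i x) = 0" "i \<in> I"
  shows "c i = 0"
  using assms unfolding lin_indep_def by simp

text \<open>Steinitz exchange: expanding \<open>u\<close> turns a relation among the new vectors
  into one among the old, with coefficient \<open>c i * p i\<close> at \<open>i\<close>. Hence
  \<open>c i = 0\<close>, and then the other coefficients vanish too.\<close>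

lemma lin_indep_exchange:
  fixes p :: "'i \<Rightarrow> real"
  assumes I: "finite I" "i \<in> I" and v: "lin_indep I v" and p: "p i \<noteq> 0"
    and u: "\<And>x. x \<in> I \<Longrightarrow> real (u x) = (\<Sum>j\<in>I. p j * v j x)"
  shows "lin_indep I (v(i := u))"
  unfolding lin_indep_def
proof (intro allI impI)
  fix c :: "'i \<Rightarrow> real"
  assume c: "\<forall>x\<in>I. (\<Sum>j\<in>I. c j * (v(i := u)) j x) = 0"
  let ?e = "\<lambda>j. c i * p j + (if j = i then 0 else c j)"
  have "(\<Sum>j\<in>I. ?e j * v j x) = 0" if x: "x \<in> I" for x
  proof -
    have "(\<Sum>j\<in>I. c j * (v(i := u)) j x) = c i * u x + (\<Sum>j\<in>I - {i}. c j * v j x)"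
      using I by (subst sum.remove[of _ i]) (auto intro!: sum.cong)
    moreover have "(\<Sum>j\<in>I. (if j = i then 0 else c j) * v j x) = (\<Sum>j\<in>I - {i}. c j * v j x)"
      using I by (subst sum.remove[of _ i]) (auto intro!: sum.cong)
    moreover have "(\<Sum>j\<in>I. ?e j * v j x) =
        c i * u x + (\<Sum>j\<in>I. (if j = i then 0 else c j) * v j x)"
      using x by (simp add: u sum_distrib_left sum.distrib distrib_right mult.assoc)
    ultimately show ?thesis using c x by simp
  qed
  then have e: "?e j = 0" if "j \<in> I" for j
    using lin_indepD[OF v, of ?e] that by blast
  have "c i = 0" using e[OF I(2)] p by simp
  then show "\<forall>j\<in>I. c j = 0" using e by (metis add_0 mult_zero_left)
qed

text \<open>The variance identity: second moment minus squared mean. It makes the strict convexity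
  of the square quantitative.\<close>

lemma jensen_square_gap:
  fixes p y :: "'i \<Rightarrow> real"
  assumes "sum p I = 1" and m: "m = (\<Sum>i\<in>I. p i * y i)"
  shows "(\<Sum>i\<in>I. p i * (y i)\<^sup>2) - m\<^sup>2 = (\<Sum>i\<in>I. p i * (y i - m)\<^sup>2)"
proof -
  have "(\<Sum>i\<in>I. p i * (y i - m)\<^sup>2) =
      (\<Sum>i\<in>I. p i * (y i)\<^sup>2) - 2 * m * (\<Sum>i\<in>I. p i * y i) + m\<^sup>2 * sum p I"
    by (simp add: power2_diff algebra_simps sum.distrib sum_subtractf sum_distrib_left
        sum_distrib_right)
  then show ?thesis using assms(1) m by (simp add: power2_eq_square)
qed

lemma splits_card:
  assumes fin: "finite I" and pos: "\<And>i. i \<in> I \<Longrightarrow> 0 < w i" and k: "card I \<le> k + 2"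
  shows "splits k I w"
  unfolding splits_def
proof (intro allI impI)
  fix q a
  define d where "d = Lcm (w ` I)"
  assume q: "k < q" and "(\<Sum>i\<in>I. a i * w i) = q * Lcm (w ` I)"
  then have deg_a: "(\<Sum>i\<in>I. a i * w i) = q * d" by (simp add: d_def)
  have d: "0 < d"
    unfolding d_def using fin pos by (metis Lcm_0_iff finite_imageI gr0I imageE)
  have ne: "I \<noteq> {}" using deg_a d q by (cases "I = {}") auto
  \<comment> \<open>Extensionality lets \<open>A\<close> be finite; positivity of the weights bounds
    each coordinate by \<open>d\<close>.\<close>
  define A where "A = {u \<in> I \<rightarrow>\<^sub>E UNIV. (\<Sum>x\<in>I. u x * w x) = d}"
  define valid where "valid = (\<lambda>v (l :: _ \<Rightarrow> real). v \<in> I \<rightarrow>\<^sub>E A \<and> lin_indep I v \<and>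
    (\<forall>i\<in>I. 0 \<le> l i) \<and> (\<forall>x\<in>I. (\<Sum>i\<in>I. l i * v i x) = a x))"
  define h where "h = (\<lambda>u :: _ \<Rightarrow> nat. \<Sum>x\<in>I. (real (u x))\<^sup>2)"
  define \<phi> where "\<phi> = (\<lambda>v (l :: _ \<Rightarrow> real). \<Sum>i\<in>I. l i * h (v i))"
  define F where "F = {\<phi> v l | v l. valid v l}"
  have "finite A"
  proof (rule finite_subset)
    show "A \<subseteq> I \<rightarrow>\<^sub>E {..d}"
    proof
      fix u assume u: "u \<in> A"
      have "u x \<le> d" if x: "x \<in> I" for x
      proof -
        have "u x \<le> u x * w x" using pos[OF x] by simp
        also have "\<dots> \<le> (\<Sum>x\<in>I. u x * w x)" using fin x member_le_sum[of x I "\<lambda>x. u x * w x"] by simp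
        finally show ?thesis using u by (simp add: A_def)
      qed
      then show "u \<in> I \<rightarrow>\<^sub>E {..d}" using u by (auto simp: A_def PiE_iff)
    qed
  qed (use fin in \<open>simp add: finite_PiE\<close>)
  \<comment> \<open>Independence makes \<open>l\<close> unique on \<open>I\<close> for given
    \<open>v\<close>, so \<open>\<phi> v l\<close> is determined by \<open>v\<close>, which ranges
    over a finite set. Thus a minimum exists without any compactness argument.\<close>
  have "finite F"
  proof (rule finite_surj)
    show "finite (I \<rightarrow>\<^sub>E A)" using fin \<open>finite A\<close> by (simp add: finite_PiE)
    show "F \<subseteq> (\<lambda>v. \<phi> v (SOME l. valid v l)) ` (I \<rightarrow>\<^sub>E A)"
    proof
      fix s assume "s \<in> F"
      then obtain v l where vl: "valid v l" and s: "s = \<phi> v l" by (auto simp: F_def)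
      define l' where "l' = (SOME l. valid v l)"
      have l': "valid v l'" unfolding l'_def using vl by (rule someI[where P = "valid v"])
      have "(\<Sum>i\<in>I. (l i - l' i) * v i x) = 0" if "x \<in> I" for x
        using vl l' that by (simp add: valid_def left_diff_distrib sum_subtractf)
      moreover have "lin_indep I v" using vl by (simp add: valid_def)
      ultimately have "l i - l' i = 0" if "i \<in> I" for i
        using lin_indepD[of I v "\<lambda>i. l i - l' i"] that by simp
      then have "s = \<phi> v l'" by (simp add: s \<phi>_def)
      then show "s \<in> (\<lambda>v. \<phi> v (SOME l. valid v l)) ` (I \<rightarrow>\<^sub>E A)"
        unfolding l'_def using vl by (intro image_eqI[of _ _ v]) (auto simp: valid_def)
    qed
  qed
  have "F \<noteq> {}"
  proof -
    \<comment> \<open>The initial basis consists of the vertices of the simplex, the pure powers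
      with exponent \<open>d div w i\<close>.\<close>
    define v where "v = (\<lambda>i\<in>I. \<lambda>x\<in>I. if x = i then d div w i else 0)"
    define l where "l = (\<lambda>i. a i / (d div w i))"
    have wd: "w i dvd d" if "i \<in> I" for i using that by (simp add: d_def)
    have wpos: "0 < d div w i" if "i \<in> I" for i
      using wd[OF that] d pos[OF that] by (simp add: div_greater_zero_iff dvd_imp_le)
    have sv: "(\<Sum>i\<in>I. c i * v i x) = c x * (d div w x)" if "x \<in> I" for x and c :: "_ \<Rightarrow> real"
    proof -
      have "(\<Sum>i\<in>I. c i * v i x) = (\<Sum>i\<in>I. if i = x then c x * (d div w x) else 0)"
        using that by (intro sum.cong) (auto simp: v_def)
      then show ?thesis using that fin by simp
    qed
    have "v i \<in> A" if i: "i \<in> I" for i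
    proof -
      have "(\<Sum>x\<in>I. v i x * w x) = (\<Sum>x\<in>I. if x = i then d else 0)"
        using i wd by (intro sum.cong) (auto simp: v_def)
      then show ?thesis using i fin by (auto simp: A_def v_def)
    qed
    then have "v \<in> I \<rightarrow>\<^sub>E A" by (auto simp: v_def)
    moreover have "lin_indep I v"
      using wpos by (force simp: lin_indep_def sv)
    moreover have "(\<Sum>i\<in>I. l i * v i x) = a x" if "x \<in> I" for x
      using wpos[OF that] by (subst sv[OF that]) (simp add: l_def)
    ultimately have "valid v l" by (simp add: valid_def l_def)
    then show ?thesis by (auto simp: F_def)
  qed
  obtain v l where vl: "valid v l" and min: "\<And>v' l'. valid v' l' \<Longrightarrow> \<phi> v l \<le> \<phi> v' l'"
  proof -
    have "Min F \<in> F" using \<open>finite F\<close> \<open>F \<noteq> {}\<close> by simp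
    then obtain v l where "valid v l" "Min F = \<phi> v l" by (auto simp: F_def)
    moreover have "Min F \<le> \<phi> v' l'" if "valid v' l'" for v' l'
      using \<open>finite F\<close> that by (auto simp: F_def intro!: Min_le)
    ultimately show ?thesis using that by auto
  qed
  have vA: "v i \<in> A" if "i \<in> I" for i using vl that by (auto simp: valid_def)
  have l0: "0 \<le> l i" if "i \<in> I" for i using vl that by (auto simp: valid_def)
  have ind: "lin_indep I v" using vl by (simp add: valid_def)
  have rep: "(\<Sum>i\<in>I. l i * v i x) = a x" if "x \<in> I" for x using vl that by (simp add: valid_def)
  have deg_v: "(\<Sum>x\<in>I. v i x * w x) = d" if "i \<in> I" for i
    using vA[OF that] by (simp add: A_def)
  \<comment> \<open>Take weighted degrees in \<open>rep\<close>: every \<open>v i\<close>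
    contributes \<open>d\<close>, and \<open>a\<close> has degree \<open>q * d\<close>.\<close>
  have suml: "sum l I = q"
  proof -
    have "real (q * d) = (\<Sum>x\<in>I. a x * w x)" by (simp add: deg_a)
    also have "\<dots> = (\<Sum>x\<in>I. (\<Sum>i\<in>I. l i * v i x) * w x)" by (simp add: rep)
    also have "\<dots> = (\<Sum>i\<in>I. \<Sum>x\<in>I. l i * v i x * w x)"
      by (subst sum.swap) (simp add: sum_distrib_right)
    also have "\<dots> = (\<Sum>i\<in>I. l i * real (\<Sum>x\<in>I. v i x * w x))"
      by (simp add: sum_distrib_left mult.assoc)
    also have "\<dots> = sum l I * d" by (simp add: deg_v sum_distrib_right)
    finally show ?thesis using d by simp
  qed
  have "\<exists>i\<in>I. 1 \<le> l i"
  proof (rule ccontr)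
    assume "\<not> (\<exists>i\<in>I. 1 \<le> l i)"
    then have l1: "l i < 1" if "i \<in> I" for i using that by force
    \<comment> \<open>This gives \<open>q < card I\<close>, while
      \<open>card I \<le> k + 2 \<le> q + 1\<close>, so only \<open>card I = q + 1\<close> is
      left.\<close>
    have "sum l I < (\<Sum>i\<in>I. 1)" using fin ne l1 by (intro sum_strict_mono) auto
    then have "q < card I" using suml by simp
    then have cq: "card I = q + 1" and two: "2 \<le> card I" using k q by auto
    \<comment> \<open>The other \<open>q\<close> coefficients, at least one in number, are all below
      1 and so cannot already add up to \<open>q\<close>.\<close>
    have lpos: "0 < l i" if i: "i \<in> I" for i
    proof -
      have "I - {i} \<noteq> {}" using two card_mono[of "{i}" I] by auto
      then have "sum l (I - {i}) < (\<Sum>j\<in>I - {i}. 1)" using fin l1 by (intro sum_strict_mono) auto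
      also have "\<dots> = q" using fin i cq by simp
      finally show ?thesis using suml fin i by (simp add: sum.remove[of _ i])
    qed
    \<comment> \<open>These coefficients are positive with sum \<open>(q + 1) - q = 1\<close>, so
      \<open>u\<close> below is a convex combination of the \<open>v i\<close> in which each one
      takes part.\<close>
    define p where "p = (\<lambda>i. 1 - l i)"
    have ppos: "0 < p i" if "i \<in> I" for i using l1[OF that] by (simp add: p_def)
    have sump: "sum p I = 1" using suml cq by (simp add: p_def sum_subtractf)
    \<comment> \<open>The truncated subtraction loses nothing: \<open>l i < 1\<close> for all
      \<open>i\<close> bounds \<open>a x\<close> by the sum of the \<open>v i x\<close>.\<close>
    define u where "u = (\<lambda>x\<in>I. (\<Sum>i\<in>I. v i x) - a x)"
    have au: "a x + u x = (\<Sum>i\<in>I. v i x)" if x: "x \<in> I" for x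
    proof -
      have "real (a x) \<le> (\<Sum>i\<in>I. 1 * real (v i x))"
        unfolding rep[OF x, symmetric] using l1
        by (intro sum_mono mult_right_mono) (auto simp: less_imp_le)
      then have "a x \<le> (\<Sum>i\<in>I. v i x)" by (simp flip: of_nat_sum)
      then show ?thesis using x by (simp add: u_def)
    qed
    have u: "real (u x) = (\<Sum>i\<in>I. p i * v i x)" if x: "x \<in> I" for x
    proof -
      have "real (a x) + u x = (\<Sum>i\<in>I. real (v i x))"
        using au[OF x] by (simp flip: of_nat_sum of_nat_add)
      then show ?thesis by (simp add: p_def left_diff_distrib sum_subtractf rep[OF x])
    qed
    have uA: "u \<in> A"
    proof -
      have "q * d + (\<Sum>x\<in>I. u x * w x) = (\<Sum>x\<in>I. (a x + u x) * w x)"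
        by (simp add: deg_a[symmetric] distrib_right sum.distrib)
      also have "\<dots> = (\<Sum>x\<in>I. \<Sum>i\<in>I. v i x * w x)" by (simp add: au sum_distrib_right)
      also have "\<dots> = (\<Sum>i\<in>I. \<Sum>x\<in>I. v i x * w x)" by (rule sum.swap)
      also have "\<dots> = q * d + d" by (simp add: deg_v cq)
      finally show ?thesis by (simp add: A_def u_def)
    qed
    \<comment> \<open>Ratio test of the simplex method: the least ratio is the largest
      \<open>t\<close> keeping all \<open>l j - t * p j\<close> nonnegative. It cancels the
      coefficient at \<open>i\<close>, which frees the place of \<open>v i\<close> for
      \<open>u\<close>.\<close>
    obtain i where i: "i \<in> I" and imin: "\<And>j. j \<in> I \<Longrightarrow> l i / p i \<le> l j / p j"
    proof -
      let ?m = "Min ((\<lambda>j. l j / p j) ` I)"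
      have "?m \<in> (\<lambda>j. l j / p j) ` I" using fin ne by simp
      then obtain i where i: "i \<in> I" "?m = l i / p i" by (rule imageE)
      have "?m \<le> l j / p j" if "j \<in> I" for j using fin that by (intro Min_le) auto
      then show ?thesis using i that by simp
    qed
    define t where "t = l i / p i"
    have t: "0 < t" using lpos ppos i by (simp add: t_def)
    have ti: "l i - t * p i = 0" using ppos[OF i] by (simp add: t_def)
    define v' where "v' = v(i := u)"
    define l' where "l' = (\<lambda>j. if j = i then t else l j - t * p j)"
    \<comment> \<open>Used twice: with \<open>g\<close> a coordinate, to see that \<open>a\<close>
      is still represented, and with \<open>g = h\<close>, to compute the new
      \<open>\<phi>\<close>.\<close>
    have exch: "(\<Sum>j\<in>I. l' j * g (v' j)) = t * g u + (\<Sum>j\<in>I. (l j - t * p j) * g (v j))"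
      for g :: "_ \<Rightarrow> real"
    proof -
      have "(\<Sum>j\<in>I. l' j * g (v' j)) = t * g u + (\<Sum>j\<in>I - {i}. (l j - t * p j) * g (v j))"
        using fin i by (subst sum.remove[of _ i]) (auto simp: l'_def v'_def intro!: sum.cong)
      then show ?thesis using fin i ti by (simp add: sum.remove[of I i])
    qed
    have "valid v' l'"
      unfolding valid_def
    proof (intro conjI ballI)
      show "v' \<in> I \<rightarrow>\<^sub>E A" using vl uA i by (auto simp: valid_def v'_def PiE_iff extensional_def)
      show "lin_indep I v'"
        unfolding v'_def using ppos[OF i] u by (intro lin_indep_exchange[OF fin i ind]) auto
      show "0 \<le> l' j" if "j \<in> I" for j
        using imin[OF that] ppos[OF that] t by (simp add: l'_def t_def[symmetric] field_simps)
      show "(\<Sum>j\<in>I. l' j * v' j x) = a x" if x: "x \<in> I" for x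
        using exch[of "\<lambda>y. y x"]
        by (simp add: u[OF x] rep[OF x, symmetric] left_diff_distrib sum_subtractf
            sum_distrib_left mult.assoc)
    qed
    \<comment> \<open>The value drops by \<open>t\<close> times the gap between the
      \<open>p\<close>-mean of \<open>h (v j)\<close> and \<open>h u\<close>, which is a sum of
      variances over the coordinates.\<close>
    moreover have "\<phi> v' l' < \<phi> v l"
    proof -
      have "(\<Sum>j\<in>I. p j * h (v j)) - h u =
          (\<Sum>x\<in>I. (\<Sum>j\<in>I. p j * (real (v j x))\<^sup>2) - (real (u x))\<^sup>2)"
        unfolding h_def sum_distrib_left sum_subtractf by (subst sum.swap) simp
      also have "\<dots> = (\<Sum>x\<in>I. \<Sum>j\<in>I. p j * (real (v j x) - u x)\<^sup>2)"
        using sump u by (intro sum.cong jensen_square_gap) auto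
      \<comment> \<open>If all variances were zero, every \<open>v j\<close> would agree with
        \<open>u\<close> on \<open>I\<close>; as \<open>I\<close> has two distinct elements, the
        relation \<open>v i - v j = 0\<close> would contradict independence.\<close>
      also have "\<dots> > 0"
      proof (rule ccontr)
        assume "\<not> 0 < (\<Sum>x\<in>I. \<Sum>j\<in>I. p j * (real (v j x) - u x)\<^sup>2)"
        moreover have nn: "0 \<le> (\<Sum>j\<in>I. p j * (real (v j x) - u x)\<^sup>2)" for x
          using ppos by (intro sum_nonneg) (auto intro!: mult_nonneg_nonneg simp: less_imp_le)
        ultimately have "(\<Sum>x\<in>I. \<Sum>j\<in>I. p j * (real (v j x) - u x)\<^sup>2) = 0"
          by (meson antisym not_less sum_nonneg)
        then have "(\<Sum>j\<in>I. p j * (real (v j x) - u x)\<^sup>2) = 0" if "x \<in> I" for x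
          using that fin nn by (simp add: sum_nonneg_eq_0_iff)
        then have "p j * (real (v j x) - u x)\<^sup>2 = 0" if "x \<in> I" "j \<in> I" for x j
          using that fin ppos sum_nonneg_eq_0_iff[of I "\<lambda>j. p j * (real (v j x) - u x)\<^sup>2"]
          by (force simp: less_imp_le)
        then have eq: "v j x = u x" if "x \<in> I" "j \<in> I" for x j
          using that ppos[of j] by fastforce
        have "\<not> I \<subseteq> {i}" using two card_mono[of "{i}" I] by auto
        then obtain j where j: "j \<in> I" "j \<noteq> i" by blast
        define c where "c = (\<lambda>m. if m = i then 1 else if m = j then - 1 else (0::real))"
        have "(\<Sum>m\<in>I. c m * v m x) = 0" if x: "x \<in> I" for x
        proof -
          have "(\<Sum>m\<in>I. c m * v m x) = u x * (\<Sum>m\<in>I. c m)"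
            using x by (simp add: eq sum_distrib_right mult.commute)
          also have "(\<Sum>m\<in>I. c m) = (\<Sum>m\<in>I. (if m = i then 1 else 0) - (if m = j then 1 else 0))"
            using j by (intro sum.cong) (auto simp: c_def)
          also have "\<dots> = 0" using fin i j by (simp add: sum_subtractf)
          finally show ?thesis by simp
        qed
        then have "c i = 0" using lin_indepD[OF ind] i by blast
        then show False by (simp add: c_def)
      qed
      finally have "t * h u < t * (\<Sum>j\<in>I. p j * h (v j))" using t by simp
      then show ?thesis unfolding \<phi>_def exch
        by (simp add: left_diff_distrib sum_subtractf sum_distrib_left mult.assoc)
    qed
    ultimately show False using min by fastforce
  qed
  then obtain i where i: "i \<in> I" "1 \<le> l i" by blast
  \<comment> \<open>The other terms of the representation are nonnegative and may be
    dropped.\<close>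
  have "v i x \<le> a x" if x: "x \<in> I" for x
  proof -
    have "real (v i x) \<le> l i * v i x" using i by (simp add: mult_le_cancel_right1)
    also have "\<dots> \<le> (\<Sum>j\<in>I. l j * v j x)"
      using fin i l0 member_le_sum[of i I "\<lambda>j. l j * v j x"] by simp
    finally show ?thesis using rep[OF x] by simp
  qed
  then show "\<exists>b. (\<forall>i\<in>I. b i \<le> a i) \<and> (\<Sum>i\<in>I. b i * w i) = Lcm (w ` I)"
    using deg_v[OF i(1)] by (auto simp: d_def)
qed

section \<open>From splitting to generation in degree 1\<close>

text \<open>Divisors of degree \<open>Lcm (w\<close>
  I)\<open>are removed one by one until degree\<close>k * Lcm (w \<open>I)\<close> is reached;
  \<open>b\<close> is what remains, not what was removed.\<close>

lemma splits_multiple: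
  assumes S: "splits k I w" and "k \<le> q" "(\<Sum>i\<in>I. a i * w i) = q * Lcm (w ` I)"
  obtains b where "\<And>i. i \<in> I \<Longrightarrow> b i \<le> a i" "(\<Sum>i\<in>I. b i * w i) = k * Lcm (w ` I)"
  using assms(2,3)
proof (induction q arbitrary: a thesis rule: dec_induct)
  case base
  then show ?case by blast
next
  case (step q)
  have "k < Suc q" using step.hyps by simp
  then obtain c where c: "\<And>i. i \<in> I \<Longrightarrow> c i \<le> a i" "(\<Sum>i\<in>I. c i * w i) = Lcm (w ` I)"
    using splitsD[OF S _ step.prems(2)] by blast
  have "(\<Sum>i\<in>I. (a i - c i) * w i) + (\<Sum>i\<in>I. c i * w i) = (\<Sum>i\<in>I. a i * w i)"
    unfolding sum.distrib[symmetric] using c(1)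
    by (intro sum.cong) (simp_all flip: distrib_right)
  then have "(\<Sum>i\<in>I. (a i - c i) * w i) = q * Lcm (w ` I)" using step.prems(2) c(2) by simp
  from step.IH[OF _ this] obtain b where
    b: "\<And>i. i \<in> I \<Longrightarrow> b i \<le> a i - c i" "(\<Sum>i\<in>I. b i * w i) = k * Lcm (w ` I)" by blast
  have "b i \<le> a i" if "i \<in> I" for i using b(1)[OF that] by simp
  then show ?case using b(2) by (rule step.prems(1))
qed

text \<open>The descent is applied with \<open>q = k * m\<close>, which is at least \<open>k\<close>
  because \<open>m\<close> is positive.\<close>

lemma exponent_split:
  assumes S: "splits k {..<length w} ((!) w)" and m: "1 \<le> m"
    and a: "Poly_Mapping.keys a \<subseteq> {..<length w}" "weighted_degree w a = k * Lcm (set w) * m"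
  obtains b c where "a = b + c" "Poly_Mapping.keys b \<subseteq> {..<length w}"
    "Poly_Mapping.keys c \<subseteq> {..<length w}" "weighted_degree w b = k * Lcm (set w)"
proof -
  have L: "(!) w ` {..<length w} = set w" by (auto simp: in_set_conv_nth)
  have km: "k \<le> k * m" using m by simp
  have "(\<Sum>i<length w. Poly_Mapping.lookup a i * w ! i) = k * m * Lcm ((!) w ` {..<length w})"
    using a(2) by (simp add: weighted_degree_def L mult.commute mult.left_commute)
  then obtain f where f: "\<And>i. i \<in> {..<length w} \<Longrightarrow> f i \<le> Poly_Mapping.lookup a i"
      "(\<Sum>i<length w. f i * w ! i) = k * Lcm (set w)"
    using splits_multiple[OF S km, of "Poly_Mapping.lookup a"] unfolding L by blast
  define b where "b = (\<Sum>i<length w. Poly_Mapping.single i (f i))"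
  have b: "Poly_Mapping.lookup b i = (if i < length w then f i else 0)" for i
    by (simp add: b_def lookup_sum lookup_single when_def)
  have "Poly_Mapping.lookup b i \<le> Poly_Mapping.lookup a i" for i using f(1)[of i] by (simp add: b)
  then have "a = b + (a - b)" by (intro poly_mapping_eqI) (simp add: lookup_add lookup_minus)
  moreover have "Poly_Mapping.keys b \<subseteq> {..<length w}"
    using b by (auto simp: in_keys_iff split: if_splits)
  moreover have "Poly_Mapping.keys (a - b) \<subseteq> {..<length w}"
  proof
    fix x assume "x \<in> Poly_Mapping.keys (a - b)"
    then have "Poly_Mapping.lookup a x - Poly_Mapping.lookup b x \<noteq> 0"
      by (simp only: in_keys_iff lookup_minus not_False_eq_True)
    then have "x \<in> Poly_Mapping.keys a" by (simp add: in_keys_iff)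
    then show "x \<in> {..<length w}" using a(1) by blast
  qed
  moreover have "weighted_degree w b = k * Lcm (set w)"
    using f(2) by (simp add: weighted_degree_def b)
  ultimately show ?thesis by (rule that)
qed

section \<open>Factoring monomials\<close>

lemma single_in_weighted_poly:
  "Poly_Mapping.keys a \<subseteq> {..<length w} \<Longrightarrow>
    Poly_Mapping.single a c \<in> weighted_poly w (weighted_degree w a)"
  by (auto simp: weighted_poly_def poly_ring_def)

text \<open>Factors are split off one at a time with coefficient 1; the last one carries the
  coefficient \<open>c\<close>.\<close>

lemma monomial_factorization:
  fixes c :: "'q::comm_ring_1"
  assumes S: "splits k {..<length w} ((!) w)" and m: "1 \<le> m"
    and a: "Poly_Mapping.keys a \<subseteq> {..<length w}" "weighted_degree w a = k * Lcm (set w) * m"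
  shows "\<exists>xs. length xs = m \<and> set xs \<subseteq> weighted_poly w (k * Lcm (set w)) \<and>
    prod_list xs = Poly_Mapping.single a c"
  using m a
proof (induction m arbitrary: a rule: dec_induct)
  case base
  then show ?case
    using single_in_weighted_poly[of a w c] by (intro exI[of _ "[Poly_Mapping.single a c]"]) simp
next
  case (step m)
  obtain b e where be: "a = b + e" "Poly_Mapping.keys b \<subseteq> {..<length w}"
    "Poly_Mapping.keys e \<subseteq> {..<length w}" "weighted_degree w b = k * Lcm (set w)"
    using exponent_split[OF S _ step.prems] by auto
  have "weighted_degree w e = k * Lcm (set w) * m"
    using step.prems(2) be(1,4) by (simp add: weighted_degree_add)
  then obtain xs where "length xs = m" "set xs \<subseteq> weighted_poly w (k * Lcm (set w))"
    "prod_list xs = Poly_Mapping.single e c"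
    using step.IH[OF be(3)] by blast
  moreover have "Poly_Mapping.single b (1::'q) \<in> weighted_poly w (k * Lcm (set w))"
    using single_in_weighted_poly[OF be(2)] be(4) by metis
  ultimately show ?case
    by (intro exI[of _ "Poly_Mapping.single b 1 # xs"]) (simp add: be(1) mult_single)
qed

section \<open>Veronese subrings\<close>

lemma prod_list_graded_ring:
  assumes "graded_ring S" "set xs \<subseteq> S r"
  shows "prod_list xs \<in> S (r * length xs)"
  using assms(2)
proof (induction xs)
  case Nil
  then show ?case using assms(1) by (simp add: graded_ring_def)
next
  case (Cons x xs)
  then have "x * prod_list xs \<in> S (r + r * length xs)"
    using assms(1) by (simp add: graded_ring_def)
  then show ?case by simp
qed

lemma is_direct_sum_veronese:
  assumes "graded_ring S" "0 < r"
  shows "is_direct_sum (ring_of (veronese r S)) (veronese r S)"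
  unfolding is_direct_sum_def
proof (intro conjI allI impI)
  have S: "is_direct_sum (ring_of S) S" using assms(1) by (simp add: graded_ring_def)
  show "add_subgroup (veronese r S m)" for m
    using S by (simp add: is_direct_sum_def veronese_def)
  show "ring_of (veronese r S) = add_subgroup hull (\<Union>m. veronese r S m)"
    by (simp add: ring_of_def)
  fix I f
  assume I: "finite I" "\<forall>m\<in>I. f m \<in> veronese r S m" "(\<Sum>m\<in>I. f m) = 0"
  have inj: "inj_on ((*) r) I" using assms(2) by (simp add: inj_on_def)
  \<comment> \<open>The family is moved to the degrees \<open>r * m\<close>, where
    \<open>div r\<close> recovers the index, so that independence in \<open>S\<close>
    applies.\<close>
  have "\<forall>m\<in>(*) r ` I. f (m div r) \<in> S m" using I(2) assms(2) by (simp add: veronese_def)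
  moreover have "(\<Sum>m\<in>(*) r ` I. f (m div r)) = 0"
    using I(3) assms(2) by (simp add: sum.reindex[OF inj])
  ultimately have "\<forall>m\<in>(*) r ` I. f (m div r) = 0"
    using S I(1) unfolding is_direct_sum_def
    by (auto dest!: spec[of _ "(*) r ` I"] spec[of _ "\<lambda>m. f (m div r)"])
  then show "\<forall>m\<in>I. f m = 0" using assms(2) by simp
qed

text \<open>One inclusion is the grading. For the other, a polynomial is the sum of its terms, and
  each term factors.\<close>

lemma set_power_weighted_poly:
  assumes S: "splits k {..<length w} ((!) w)" and m: "1 \<le> m"
  shows "set_power (weighted_poly w (k * Lcm (set w)) :: 'q::comm_ring_1 mpoly set) m =
    weighted_poly w (k * Lcm (set w) * m)"
proof
  let ?X = "weighted_poly w (k * Lcm (set w)) :: 'q mpoly set"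
  show "set_power ?X m \<subseteq> weighted_poly w (k * Lcm (set w) * m)"
    unfolding set_power_def
    using prod_list_graded_ring[OF graded_ring_weighted_poly]
    by (intro hull_minimal) (auto simp: add_subgroup_weighted_poly)
  show "weighted_poly w (k * Lcm (set w) * m) \<subseteq> set_power ?X m"
  proof
    fix p :: "'q mpoly" assume p: "p \<in> weighted_poly w (k * Lcm (set w) * m)"
    have "Poly_Mapping.single a (Poly_Mapping.lookup p a) \<in> set_power ?X m"
      if "a \<in> Poly_Mapping.keys p" for a
    proof -
      have a: "Poly_Mapping.keys a \<subseteq> {..<length w}" "weighted_degree w a = k * Lcm (set w) * m"
        using p that by (auto simp: weighted_poly_def poly_ring_def)
      obtain xs where xs: "length xs = m" "set xs \<subseteq> ?X"
        "prod_list xs = Poly_Mapping.single a (Poly_Mapping.lookup p a)"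
        using monomial_factorization[OF S m a] by blast
      show ?thesis unfolding set_power_def xs(3)[symmetric] using xs(1,2) by (intro hull_inc) blast
    qed
    then have "(\<Sum>a\<in>Poly_Mapping.keys p. Poly_Mapping.single a (Poly_Mapping.lookup p a))
        \<in> set_power ?X m"
      by (intro add_subgroup_sum) (auto simp: set_power_def add_subgroup_hull)
    then show "p \<in> set_power ?X m" by (simp only: mpoly_sum_monomials[symmetric])
  qed
qed

lemma generated_in_degree_1_veronese_weighted_poly:
  assumes S: "splits k {..<length w} ((!) w)" and k: "1 \<le> k" and w: "0 < Lcm (set w)"
  shows "generated_in_degree_1
    (veronese (k * Lcm (set w)) (weighted_poly w :: nat \<Rightarrow> 'q::comm_ring_1 mpoly set))"
proof -
  let ?V = "veronese (k * Lcm (set w)) (weighted_poly w :: nat \<Rightarrow> 'q mpoly set)"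
  \<comment> \<open>The family in the definition of generation in degree 1 is the Veronese family
    itself, so directness is inherited from the grading.\<close>
  have "(\<lambda>m. if m = 0 then ?V 0 else set_power (?V 1) m) = ?V"
    by (rule ext) (simp add: veronese_def set_power_weighted_poly[OF S, simplified])
  then show ?thesis
    using is_direct_sum_veronese[OF graded_ring_weighted_poly, of "k * Lcm (set w)" w] k w
    by (simp add: generated_in_degree_1_def)
qed

theorem theorem1p24:
  fixes n k N :: nat and w :: "nat list"
    and P :: "nat \<Rightarrow> 'q::comm_ring_1 mpoly set"
  assumes "n \<ge> 1"
    and "length w = n"
    and "\<forall>i<n. w ! i \<ge> 1"
    and "P = weighted_poly w"
    and "N = least_weak_length w"
    and "int k \<ge> max 1 (int N - 2)"
  shows "generated_in_degree_1 (veronese (k * Lcm (set w)) P)"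
proof -
  have pos: "\<forall>x\<in>set w. x \<ge> 1" using assms(2,3) by (metis in_set_conv_nth)
  then have "weight_vector w" using assms(1,2) by (auto simp: weight_vector_def)
  then have "\<exists>l v. weakly_equivalent v w \<and> length v = l"
    unfolding weakly_equivalent_def by blast
  then have "\<exists>v. weakly_equivalent v w \<and> length v = N"
    unfolding assms(5) least_weak_length_def by (rule LeastI_ex)
  then obtain v where v: "weakly_equivalent v w" "length v = N" by blast
  \<comment> \<open>The least length enters here: \<open>N \<le> k + 2\<close> is the bound in
    \<open>splits_card\<close>. Splitting is then carried back from \<open>v\<close> to
    \<open>w\<close>.\<close>
  have "splits k {..<length v} ((!) v)"
  proof (rule splits_card)
    show "0 < v ! i" if "i \<in> {..<length v}" for i
    proof -
      have "v ! i \<in> set v" using that by simp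
      then show ?thesis
        using v(1) by (simp add: weakly_equivalent_def weight_vector_def Suc_le_eq)
    qed
  qed (use v(2) assms(6) in auto)
  then have "splits k {..<length w} ((!) w)"
    using splits_weakly_equivalent[OF v(1)] by (simp add: splits_nth)
  moreover have "0 < Lcm (set w)"
  proof (rule gr0I)
    assume "Lcm (set w) = 0"
    then have "0 \<in> set w" using Lcm_0_iff[of "set w"] by blast
    then show False using pos by force
  qed
  ultimately show ?thesis
    unfolding assms(4) using assms(6) by (intro generated_in_degree_1_veronese_weighted_poly) auto
qed

end
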